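(* Let $\{f_n(x)\}_{n\in\mathbb{N}}$ be a chain in $\mathbb{Q}[x]$ such that: (i) for all $n\in\mathbb{N}$, $f_n(x)$ is monic; (ii) for all $n\in\mathbb{N}$, $f_n(x)\in\mathbb{Z}[x]$; (iii) for all $m,n\in\mathbb{N}$, $m\mid n$ if and only if $f_m(x)\mid f_n(x)$ in $\mathbb{Q}[x]$. Then either $f_n(x)=2T_n\left(\frac{x}{2}+1\right)-2$ for all $n\in\mathbb{N}$, or $f_n(x)=(x+1)^n-1$ for all $n\in\mathbb{N}$. Additionally, in this case $\gcd(f_m(x),f_n(x))=f_{\gcd(m,n)}(x)$ for all $m,n\in\mathbb{N}$.
   Context: $\mathbb{N}$ denotes the positive integers. A chain in $K[x]$ is a family of polynomials $\{f_n(x)\}_{n\in\mathbb{N}}\subset K[x]$ with $\deg f_n=n$ for every $n$ and such that any two members commute under composition: $f_m(f_n(x))=f_n(f_m(x))$ for all $m,n$. $T_n(x)$ is the Chebyshev polynomial of the first kind: $T_0(x)=1$, $T_1(x)=x$, $T_n(x)=2xT_{n-1}(x)-T_{n-2}(x)$ for $n\ge 2$. The gcd of polynomials is the monic greatest common divisor in $\mathbb{Q}[x]$. *)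

theory Defs
  imports
    "HOL-Computational_Algebra.Computational_Algebra"
    "HOL-Computational_Algebra.Field_as_Ring"
begin

text \<open>\<^theory>\<open>HOL-Computational_Algebra.Field_as_Ring\<close> makes \<^typ>\<open>rat\<close> an instance of
  \<^class>\<open>field_gcd\<close>; the resulting gcd on \<^typ>\<open>rat poly\<close> is normalized to be monic.\<close>

fun chebyshev_T :: "nat \<Rightarrow> 'a::comm_ring_1 poly" where
  "chebyshev_T 0 = 1"
| "chebyshev_T (Suc 0) = [:0, 1:]"
| "chebyshev_T (Suc (Suc n)) = 2 * [:0, 1:] * chebyshev_T (Suc n) - chebyshev_T n"

text \<open>A chain is indexed by the positive integers, so the value of the sequence at index
  0 is irrelevant.\<close>

definition poly_chain :: "(nat \<Rightarrow> 'a::field poly) \<Rightarrow> bool" where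
  "poly_chain f \<longleftrightarrow>
     (\<forall>n>0. degree (f n) = n) \<and>
     (\<forall>m>0. \<forall>n>0. pcompose (f m) (f n) = pcompose (f n) (f m))"

end

theory Submission
  imports Defs
begin

text \<open>Since $f_1$ commutes with $f_2$, it is $x$, so every $f_n$ vanishes at $0$ and
  $f_2 = x^2 + bx$. Comparing coefficients in $f_3 \circ f_2 = f_2 \circ f_3$ leaves
  $b \in \{0, 2, 4\}$, and $b = 0$ forces $f_2 = x^2 \mid x^3 = f_3$, which is excluded.
  At most one monic polynomial of each degree commutes with $f_2$, which identifies the chain.

  For the Chebyshev case of the gcd formula, let $U_n$ be defined by $U_0 = 0$, $U_1 = 1$ and
  $U_{n+2} = s U_{n+1} - U_n$. Then $f_n(s^2 - 4) = (s^2 - 4)\,U_n(s)^2$, and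
  $\gcd(U_m, U_n) = U_{\gcd(m,n)}$ bounds the degree of $\gcd(f_m, f_n)$ by $\gcd(m,n)$, while
  $f_{\gcd(m,n)}$ divides it by hypothesis.\<close>

section \<open>Polynomials commuting with a quadratic\<close>

lemma degree1_poly_eq: "degree p = 1 \<Longrightarrow> p = [:coeff p 0, coeff p 1:]"
  by (rule poly_eqI) (auto simp: coeff_pCons coeff_eq_0 split: nat.split)

lemma degree2_poly_eq: "degree p = 2 \<Longrightarrow> p = [:coeff p 0, coeff p 1, coeff p 2:]"
  by (rule poly_eqI) (auto simp: coeff_pCons coeff_eq_0 numeral_2_eq_2 split: nat.split)

lemma degree3_poly_eq: "degree p = 3 \<Longrightarrow> p = [:coeff p 0, coeff p 1, coeff p 2, coeff p 3:]"
  by (rule poly_eqI)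
    (auto simp: coeff_pCons coeff_eq_0 numeral_2_eq_2 numeral_3_eq_3 split: nat.split)

text \<open>The coefficients of x already give \<open>2 * c + b = b\<close>.\<close>

lemma degree_1_commutes_quadratic:
  fixes c d b :: "'a::field_char_0"
  assumes "pcompose [:c, 1:] [:d, b, 1:] = pcompose [:d, b, 1:] [:c, 1:]"
  shows "c = 0"
  using assms by (simp add: pcompose_pCons)

lemma cubic_commutes_quadratic:
  fixes b p q :: "'a::field_char_0"
  assumes "pcompose [:0, q, p, 1:] [:0, b, 1:] = pcompose [:0, b, 1:] [:0, q, p, 1:]"
  shows "b = 0 \<and> p = 0 \<and> q = 0 \<or> b = 2 \<or> b = 4"
proof -
  note e = assms[simplified pcompose_pCons, simplified]
  \<comment> \<open>\<open>e5\<close>, \<open>e4\<close> and \<open>e3\<close> compare the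
    coefficients of x^5, x^4 and x^3. The first two express \<open>p\<close> and \<open>q\<close>
    through \<open>b\<close>; the third then becomes a cubic equation in \<open>b\<close>.\<close>
  have e5: "2 * p = 3 * b" using e by algebra
  have e4: "2 * q + p\<^sup>2 = 3 * b\<^sup>2 + p" using e by algebra
  have e3: "b ^ 3 + 2 * p * b = 2 * p * q + b" using e by algebra
  have p: "p = 3 * b / 2" using e5 by (simp add: field_simps)
  have q: "q = 3 * b\<^sup>2 / 8 + 3 * b / 4"
  proof -
    have "8 * q = 3 * b\<^sup>2 + 6 * b" using e4 e5 by algebra
    then show ?thesis by (simp add: field_simps)
  qed
  have "b * (b - 2) * (b - 4) = 0"
    using e3 unfolding p q by (simp add: field_simps power2_eq_square power3_eq_cube)
  then show ?thesis using p q by auto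
qed

text \<open>Subtracting the two equations makes the right-hand side factor as
  \<open>(P - Q) * (P + Q + [:b:])\<close>. Composition with a quadratic doubles the degree of
  \<open>P - Q\<close>, while the second factor has degree \<open>n\<close>, so a nonzero
  \<open>P - Q\<close> would have degree \<open>n\<close>; but the leading terms cancel.\<close>

lemma monic_commuting_with_quadratic_unique:
  fixes P Q :: "'a::field_char_0 poly"
  assumes n: "n > 0" and P: "degree P = n" "lead_coeff P = 1"
    and Q: "degree Q = n" "lead_coeff Q = 1"
    and cP: "pcompose P [:0, b, 1:] = P\<^sup>2 + smult b P"
    and cQ: "pcompose Q [:0, b, 1:] = Q\<^sup>2 + smult b Q"
  shows "P = Q"
proof (rule ccontr)
  assume "P \<noteq> Q"
  define S where "S = P + Q + [:b:]"
  have "coeff S n = 2"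
    using P Q n by (simp add: S_def coeff_pCons split: nat.split)
  moreover have "degree S \<le> n"
    unfolding S_def using P Q by (intro degree_add_le) auto
  ultimately have S: "degree S = n" "S \<noteq> 0"
    by (auto intro!: antisym le_degree)
  have "degree (P - Q) < n"
  proof -
    have "degree (P - Q) \<le> n" using P Q by (intro degree_diff_le) auto
    moreover have "coeff (P - Q) n = 0" using P Q by simp
    ultimately show ?thesis
      using \<open>P \<noteq> Q\<close> by (metis eq_iff_diff_eq_0 leading_coeff_0_iff order_le_less)
  qed
  have "pcompose (P - Q) [:0, b, 1:] = (P - Q) * S"
    by (simp add: pcompose_diff cP cQ S_def algebra_simps smult_diff_right power2_eq_square)
  then have "degree (pcompose (P - Q) [:0, b, 1:]) = degree (P - Q) + n"
    using \<open>P \<noteq> Q\<close> S by (simp add: degree_mult_eq)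
  then have "degree (P - Q) * 2 = degree (P - Q) + n"
    by (simp add: degree_pcompose)
  with \<open>degree (P - Q) < n\<close> show False by simp
qed

section \<open>Chebyshev polynomials and their shifted form\<close>

lemma pcompose_numeral: "pcompose (numeral k) (r :: 'a::comm_ring_1 poly) = numeral k"
  by (metis of_nat_numeral of_nat_poly pcompose_const)

lemma pcompose_power: "pcompose (p ^ n) (r :: 'a::comm_ring_1 poly) = pcompose p r ^ n"
  by (induction n) (simp_all add: pcompose_1 pcompose_mult)

lemma pcompose_chebyshev_T_Suc_Suc:
  "pcompose (chebyshev_T (Suc (Suc n))) (r :: 'a::comm_ring_1 poly) =
    2 * r * pcompose (chebyshev_T (Suc n)) r - pcompose (chebyshev_T n) r"
proof -
  have "pcompose [:0, 1:] r = r" by (simp add: pcompose_pCons)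
  then show ?thesis
    by (simp only: chebyshev_T.simps pcompose_diff pcompose_mult pcompose_numeral)
qed

text \<open>The recurrence preserves this quadratic form in consecutive terms. It is the relation
  that closes the induction for the doubling identity.\<close>

lemma chebyshev_T_invariant:
  "(chebyshev_T (Suc n))\<^sup>2 - 2 * [:0, 1:] * chebyshev_T (Suc n) * chebyshev_T n + (chebyshev_T n)\<^sup>2
    = 1 - [:0, 1 :: 'a::idom:]\<^sup>2"
proof (induction n)
  case 0
  show ?case by (simp add: power2_eq_square numeral_poly)
next
  case (Suc n)
  then show ?case
    unfolding chebyshev_T.simps by algebra
qed

text \<open>This is the commutation of \<open>chebyshev_T n\<close> with
  \<open>chebyshev_T 2\<close>, or cos(2nt) computed in two ways.\<close>

lemma pcompose_chebyshev_T_double: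
  "pcompose (chebyshev_T n) (2 * [:0, 1 :: 'a::idom:]\<^sup>2 - 1) = 2 * (chebyshev_T n)\<^sup>2 - 1"
proof (induction n rule: chebyshev_T.induct)
  case 1
  show ?case by (simp add: pcompose_1)
next
  case 2
  show ?case by (simp add: pcompose_pCons)
next
  case (3 n)
  show ?case
    using chebyshev_T_invariant[of n, where 'a = 'a]
    unfolding pcompose_chebyshev_T_Suc_Suc 3 unfolding chebyshev_T.simps(3) by algebra
qed

lemma degree_chebyshev_T_le: "degree (chebyshev_T n :: 'a::comm_ring_1 poly) \<le> n"
proof (induction n rule: chebyshev_T.induct)
  case (3 n)
  have "degree (2 * [:0, 1 :: 'a:] * chebyshev_T (Suc n)) \<le> Suc (Suc n)"
    using degree_mult_le[of "2 * [:0, 1 :: 'a:]" "chebyshev_T (Suc n)"]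
      degree_mult_le[of "2 :: 'a poly" "[:0, 1 :: 'a:]"] 3(1)
    by (auto split: if_splits)
  then show ?case using 3(2) by (auto intro!: degree_diff_le)
qed auto

lemma coeff_chebyshev_T_self: "coeff (chebyshev_T (Suc n) :: 'a::comm_ring_1 poly) (Suc n) = 2 ^ n"
proof (induction n)
  case (Suc n)
  have "coeff (chebyshev_T n :: 'a poly) (Suc (Suc n)) = 0"
    using degree_chebyshev_T_le[of n, where 'a = 'a] by (intro coeff_eq_0) simp
  moreover have "2 * [:0, 1 :: 'a:] * chebyshev_T (Suc n) = smult 2 (pCons 0 (chebyshev_T (Suc n)))"
    by (simp add: numeral_poly)
  ultimately show ?case using Suc by simp
qed simp

text \<open>The leading coefficient is the product of the outer 2, the \<open>2 ^ (n - 1)\<close> of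
  \<open>chebyshev_T n\<close> and the \<open>(1/2) ^ n\<close> from the substitution.\<close>

lemma chebyshev_shift_monic:
  fixes h :: "nat \<Rightarrow> 'a::field_char_0 poly"
  assumes n: "n > 0" and h: "h n = 2 * pcompose (chebyshev_T n) [:1, 1/2:] - 2"
  shows "degree (h n) = n" "lead_coeff (h n) = 1"
proof -
  obtain k where k: "n = Suc k" using n by (cases n) auto
  have c: "coeff (chebyshev_T n :: 'a poly) n = 2 ^ k"
    unfolding k by (rule coeff_chebyshev_T_self)
  have d: "degree (chebyshev_T n :: 'a poly) = n"
    using c degree_chebyshev_T_le[of n, where 'a = 'a] by (intro antisym le_degree) auto
  have h': "h n = smult 2 (pcompose (chebyshev_T n) [:1, 1/2:]) - [:2:]"
    by (simp add: h numeral_poly)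
  have dt: "degree (pcompose (chebyshev_T n) [:1, 1/2 :: 'a:]) = n"
    by (simp add: degree_pcompose d)
  have "lead_coeff (pcompose (chebyshev_T n) [:1, 1/2 :: 'a:]) = 2 ^ k * (1/2) ^ n"
    using c by (subst lead_coeff_comp) (simp_all add: d)
  then have half: "coeff (pcompose (chebyshev_T n) [:1, 1/2 :: 'a:]) n = 1 / 2"
    unfolding dt by (simp add: k power_divide)
  have 1: "coeff (h n) n = 1"
    unfolding h' coeff_diff coeff_smult half using coeff_eq_0[of "[:2 :: 'a:]" n] n by simp
  have "degree (h n) \<le> n"
    unfolding h' using dt by (intro degree_diff_le) auto
  with 1 show "degree (h n) = n" by (intro antisym le_degree) auto
  with 1 show "lead_coeff (h n) = 1" by simp
qed

text \<open>With L(x) = x/2 + 1, the inverse of L is 2x - 2, so \<open>h n\<close> is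
  \<open>chebyshev_T n\<close> conjugated by L. The same conjugation turns 2x^2 - 1 into x^2 + 4x,
  and the doubling identity becomes the claim.\<close>

lemma chebyshev_shift_commutes:
  fixes h :: "nat \<Rightarrow> 'a::field_char_0 poly"
  assumes h: "h n = 2 * pcompose (chebyshev_T n) [:1, 1/2:] - 2"
  shows "pcompose (h n) [:0, 4, 1:] = (h n)\<^sup>2 + smult 4 (h n)"
proof -
  have "pcompose [:1, 1/2:] [:0, 4, 1 :: 'a:] = pcompose (2 * [:0, 1:]\<^sup>2 - 1) [:1, 1/2:]"
    by (simp add: pcompose_pCons pcompose_mult pcompose_diff pcompose_power pcompose_numeral
        pcompose_1 power2_eq_square numeral_poly one_pCons)
  then have "pcompose (h n) [:0, 4, 1:] =
      2 * pcompose (pcompose (chebyshev_T n) (2 * [:0, 1:]\<^sup>2 - 1)) [:1, 1/2:] - 2"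
    by (simp only: h pcompose_diff pcompose_mult pcompose_numeral flip: pcompose_assoc)
  also have "\<dots> = 2 * (2 * (pcompose (chebyshev_T n) [:1, 1/2:])\<^sup>2 - 1) - 2"
    by (simp only: pcompose_chebyshev_T_double pcompose_diff pcompose_mult pcompose_numeral
        pcompose_power pcompose_1)
  also have "\<dots> = (h n)\<^sup>2 + 4 * h n"
    unfolding h by algebra
  also have "4 * h n = smult 4 (h n)" by (simp add: numeral_poly)
  finally show ?thesis .
qed

section \<open>Gcds of sequences that follow Euclid's algorithm on indices\<close>

lemma gcd_eq_normalize_if_gcd_add:
  fixes u :: "nat \<Rightarrow> 'a::semiring_gcd"
  assumes 0: "u 0 = 0" and add: "\<And>m n. gcd (u (m + n)) (u m) = gcd (u n) (u m)"
  shows "gcd (u m) (u n) = normalize (u (gcd m n))"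
\<comment> \<open>Subtractive Euclid: \<open>add\<close> replaces the larger index by the
  difference, which lowers the sum as both indices are positive.\<close>
proof (induction "m + n" arbitrary: m n rule: less_induct)
  case less
  consider "m = 0" | "n = 0" | "m > 0" "n > 0" "m \<le> n" | "m > 0" "n > 0" "n \<le> m" by linarith
  then show ?case
  proof cases
    case 3
    then have "gcd (u (n - m)) (u m) = normalize (u (gcd (n - m) m))"
      using less[of "n - m" m] by simp
    moreover have "gcd (n - m) m = gcd m n"
      using 3 by (metis gcd.commute gcd_diff1_nat)
    ultimately show ?thesis
      using add[of m "n - m"] 3 by (simp add: gcd.commute)
  next
    case 4
    then have "gcd (u (m - n)) (u n) = normalize (u (gcd (m - n) n))"
      using less[of "m - n" n] by simp
    then show ?thesis
      using add[of n "m - n"] 4 by (simp add: gcd_diff1_nat)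
  qed (simp_all add: 0)
qed

lemma gcd_power_minus_1:
  fixes a :: "'a::{ring_gcd}"
  shows "gcd (a ^ m - 1) (a ^ n - 1) = normalize (a ^ gcd m n - 1)"
proof (rule gcd_eq_normalize_if_gcd_add)
  fix m n
  have "a ^ (m + n) - 1 = a ^ n * (a ^ m - 1) + (a ^ n - 1)"
    by (simp add: algebra_simps power_add)
  then show "gcd (a ^ (m + n) - 1) (a ^ m - 1) = gcd (a ^ n - 1) (a ^ m - 1)"
    by (metis gcd.commute gcd_add_mult)
qed simp

section \<open>Chebyshev polynomials of the second kind, rescaled\<close>

text \<open>In the variable s = 2 cos t this is sin(nt) / sin t, the second-kind polynomial of index
  \<open>n - 1\<close> at s/2. The index shift gives the value 0 at index 0, where Euclid's
  algorithm ends.\<close>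

fun chebyshev_S :: "nat \<Rightarrow> 'a::comm_ring_1 poly" where
  "chebyshev_S 0 = 0"
| "chebyshev_S (Suc 0) = 1"
| "chebyshev_S (Suc (Suc n)) = [:0, 1:] * chebyshev_S (Suc n) - chebyshev_S n"

text \<open>Again a quadratic form preserved by the recurrence. The value 1 makes consecutive terms
  coprime.\<close>

lemma chebyshev_S_invariant:
  "(chebyshev_S (Suc n))\<^sup>2 - [:0, 1 :: 'a::idom:] * chebyshev_S (Suc n) * chebyshev_S n
    + (chebyshev_S n)\<^sup>2 = 1"
proof (induction n)
  case (Suc n)
  then show ?case unfolding chebyshev_S.simps by algebra
qed simp

text \<open>Both sides obey the same recurrence in \<open>m\<close>. Modulo
  \<open>chebyshev_S (Suc m)\<close> only the last product survives, which is what the Euclidean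
  step uses.\<close>

lemma chebyshev_S_add:
  "chebyshev_S (Suc m + n) =
    chebyshev_S (Suc m) * chebyshev_S (Suc n) - chebyshev_S m * (chebyshev_S n :: 'a::idom poly)"
proof (induction m rule: chebyshev_S.induct)
  case 2
  show ?case by (simp del: mult_pCons_left)
next
  case (3 m)
  have "chebyshev_S (Suc (Suc (Suc m)) + n) =
      [:0, 1 :: 'a:] * chebyshev_S (Suc (Suc m) + n) - chebyshev_S (Suc m + n)"
    by (simp only: add_Suc chebyshev_S.simps)
  then show ?case unfolding 3 chebyshev_S.simps by algebra
qed simp

lemma degree_chebyshev_S:
  "degree (chebyshev_S (Suc n) :: 'a::idom poly) = n \<and> (chebyshev_S (Suc n) :: 'a poly) \<noteq> 0"
proof (induction n rule: less_induct)
  case (less n)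
  show ?case
  proof (cases n)
    case (Suc k)
    have a: "degree ([:0, 1:] * chebyshev_S (Suc k) :: 'a poly) = Suc k"
      using less[of k] Suc by (simp add: degree_pCons_eq)
    have b: "degree (chebyshev_S k :: 'a poly) < Suc k"
      using less[of "k - 1"] Suc by (cases k) auto
    have "degree (chebyshev_S (Suc (Suc k)) :: 'a poly) = Suc k"
      using degree_add_eq_left[of "- chebyshev_S k" "[:0, 1:] * chebyshev_S (Suc k) :: 'a poly"] a b
      by (simp del: mult_pCons_left)
    then show ?thesis using Suc by auto
  qed simp
qed

lemma coprime_chebyshev_S_Suc:
  "coprime (chebyshev_S (Suc n) :: 'a::field_gcd poly) (chebyshev_S n)"
proof (rule coprimeI)
  fix c :: "'a poly"
  assume "c dvd chebyshev_S (Suc n)" "c dvd chebyshev_S n"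
  then have "c dvd (chebyshev_S (Suc n))\<^sup>2 - [:0, 1:] * chebyshev_S (Suc n) * chebyshev_S n
      + (chebyshev_S n)\<^sup>2"
    unfolding power2_eq_square by (intro dvd_add dvd_diff dvd_mult)
  then show "c dvd 1" unfolding chebyshev_S_invariant .
qed

lemma gcd_chebyshev_S:
  "gcd (chebyshev_S m) (chebyshev_S n :: 'a::field_gcd poly) = normalize (chebyshev_S (gcd m n))"
proof (rule gcd_eq_normalize_if_gcd_add)
  fix m n
  show "gcd (chebyshev_S (m + n)) (chebyshev_S m) = gcd (chebyshev_S n) (chebyshev_S m :: 'a poly)"
  proof (cases m)
    case (Suc k)
    let ?a = "chebyshev_S (Suc k) :: 'a poly"
    have "gcd (chebyshev_S (Suc k + n)) ?a
        = gcd ?a (chebyshev_S (Suc n) * ?a + (- (chebyshev_S k * chebyshev_S n)))"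
      unfolding chebyshev_S_add by (simp add: gcd.commute mult.commute)
    also have "\<dots> = gcd ?a (chebyshev_S k * chebyshev_S n)"
      unfolding gcd_add_mult by simp
    \<comment> \<open>The factor \<open>chebyshev_S k\<close> is coprime to its successor
      \<open>?a\<close> and cancels.\<close>
    also have "\<dots> = gcd ?a (chebyshev_S n)"
      using coprime_chebyshev_S_Suc by (rule gcd_mult_right_left_cancel)
    finally show ?thesis unfolding Suc by (simp add: gcd.commute)
  qed simp
qed simp

text \<open>For s = 2 cos t the substitution x = s^2 - 4 gives x/2 + 1 = cos(2t). The left side is
  then 2 cos(2nt) - 2 = -4 sin(nt)^2, and s^2 - 4 = -4 sin(t)^2.\<close>

lemma chebyshev_shift_pcompose_square:
  fixes h :: "nat \<Rightarrow> 'a::field_char_0 poly"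
  assumes h: "h n = 2 * pcompose (chebyshev_T n) [:1, 1/2:] - 2"
  shows "pcompose (h n) [:-4, 0, 1:] = [:-4, 0, 1:] * (chebyshev_S n)\<^sup>2"
proof -
  define r :: "'a poly" where "r = pcompose [:1, 1/2:] [:-4, 0, 1:]"
  have r: "2 * r = [:0, 1:]\<^sup>2 - 2"
    by (simp add: r_def pcompose_pCons power2_eq_square numeral_poly)
  have q: "[:-4, 0, 1:] = [:0, 1 :: 'a:]\<^sup>2 - 4"
    by (simp add: power2_eq_square numeral_poly)
  have "2 * pcompose (chebyshev_T n) r - 2 = ([:0, 1:]\<^sup>2 - 4) * (chebyshev_S n)\<^sup>2"
  proof (induction n rule: chebyshev_T.induct)
    case 1
    show ?case by (simp add: pcompose_1)
  next
    case 2
    have "pcompose (chebyshev_T (Suc 0)) r = r" by (simp add: pcompose_pCons)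
    then show ?case using r by simp
  next
    case (3 n)
    then show ?case
      using chebyshev_S_invariant[of n, where 'a = 'a] r
      unfolding pcompose_chebyshev_T_Suc_Suc chebyshev_S.simps(3) by algebra
  qed
  then show ?thesis
    unfolding h q[symmetric] by (simp only: r_def pcompose_diff pcompose_mult pcompose_numeral
        pcompose_assoc)
qed

text \<open>Substituting \<open>q\<close> doubles degrees and exposes the squares of
  \<open>chebyshev_S\<close>. The substituted gcd divides
  \<open>q * (chebyshev_S (gcd m n))\<^sup>2\<close>, whose degree is 2 + 2(gcd m n - 1), twice the
  claimed bound.\<close>

lemma degree_gcd_chebyshev_shift_le:
  fixes h :: "nat \<Rightarrow> 'a::{field_char_0, field_gcd} poly"
  assumes h: "\<And>n. n > 0 \<Longrightarrow> h n = 2 * pcompose (chebyshev_T n) [:1, 1/2:] - 2"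
    and "m > 0" "n > 0"
  shows "degree (gcd (h m) (h n)) \<le> gcd m n"
proof -
  define q :: "'a poly" where "q = [:-4, 0, 1:]"
  define d where "d = gcd (h m) (h n)"
  have q: "q \<noteq> 0" by (simp add: q_def)
  have comp: "pcompose (h k) q = q * (chebyshev_S k)\<^sup>2" if "k > 0" for k
    unfolding q_def using that by (intro chebyshev_shift_pcompose_square h)
  have dvd: "pcompose d q dvd q * (chebyshev_S k)\<^sup>2" if "d dvd h k" "k > 0" for k
    using that comp by (metis dvd_def pcompose_mult)
  obtain k where k: "gcd m n = Suc k" using assms(2) by (cases "gcd m n") auto
  have "pcompose d q dvd gcd (q * (chebyshev_S m)\<^sup>2) (q * (chebyshev_S n)\<^sup>2)"
    using assms(2,3) by (intro gcd_greatest dvd) (simp_all add: d_def)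
  also have "\<dots> dvd q * (gcd (chebyshev_S m) (chebyshev_S n))\<^sup>2"
    unfolding gcd_mult_left gcd_exp by (simp only: normalize_dvd_iff dvd_refl)
  also have "\<dots> dvd q * (chebyshev_S (gcd m n))\<^sup>2"
    unfolding gcd_chebyshev_S by (intro mult_dvd_mono dvd_power_same) simp_all
  finally have "degree (pcompose d q) \<le> degree (q * (chebyshev_S (Suc k) :: 'a poly)\<^sup>2)"
    unfolding k using degree_chebyshev_S[of k, where 'a = 'a]
    by (intro dvd_imp_degree_le) (auto simp: q)
  also have "\<dots> = degree q + 2 * k"
    using degree_chebyshev_S[of k, where 'a = 'a]
    by (subst degree_mult_eq) (auto simp: q degree_power_eq)
  finally show ?thesis unfolding k d_def[symmetric] by (simp add: q_def degree_pcompose)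
qed

section \<open>Classification of the chain and the gcd formula\<close>

lemma poly_chain_classification:
  fixes f :: "nat \<Rightarrow> rat poly"
  assumes chain: "poly_chain f"
    and monic: "\<And>n. n > 0 \<Longrightarrow> lead_coeff (f n) = 1"
    and divides: "\<And>m n. m > 0 \<Longrightarrow> n > 0 \<Longrightarrow> m dvd n \<longleftrightarrow> f m dvd f n"
  shows "(\<forall>n>0. f n = 2 * pcompose (chebyshev_T n) [:1, 1/2:] - 2) \<or>
         (\<forall>n>0. f n = [:1, 1:] ^ n - 1)"
proof -
  have deg: "degree (f n) = n" if "n > 0" for n
    using chain that by (simp add: poly_chain_def)
  have comm: "pcompose (f m) (f n) = pcompose (f n) (f m)" if "m > 0" "n > 0" for m n
    using chain that by (simp add: poly_chain_def)
  have "f 1 = [:coeff (f 1) 0, 1:]"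
    using degree1_poly_eq[of "f 1"] deg[of 1] monic[of 1] by simp
  moreover have "f 2 = [:coeff (f 2) 0, coeff (f 2) 1, 1:]"
    using degree2_poly_eq[of "f 2"] deg[of 2] monic[of 2] by simp
  ultimately have f1: "f 1 = [:0, 1:]"
    using comm[of 1 2] degree_1_commutes_quadratic by (metis zero_less_numeral zero_less_one)
  have f0: "coeff (f n) 0 = 0" if "n > 0" for n
  proof -
    \<comment> \<open>Hypothesis \<open>divides\<close> applies since 1 divides every index.\<close>
    have "[:0, 1:] dvd f n" using divides[of 1 n] that f1 by simp
    then show ?thesis by auto
  qed
  define b where "b = coeff (f 2) 1"
  define p where "p = coeff (f 3) 2"
  define q where "q = coeff (f 3) 1"
  have f2: "f 2 = [:0, b, 1:]"
    using degree2_poly_eq[of "f 2"] deg[of 2] monic[of 2] f0[of 2] by (simp add: b_def)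
  have f3: "f 3 = [:0, q, p, 1:]"
    using degree3_poly_eq[of "f 3"] deg[of 3] monic[of 3] f0[of 3] by (simp add: p_def q_def)
  have commb: "pcompose (f n) [:0, b, 1:] = (f n)\<^sup>2 + smult b (f n)" if "n > 0" for n
    using comm[of n 2] that unfolding f2
    by (simp add: pcompose_pCons power2_eq_square algebra_simps)
  \<comment> \<open>Each remaining case only has to check that its candidate is monic of degree
    \<open>n\<close> and commutes with \<open>f 2\<close>.\<close>
  have unique: "f n = P" if "n > 0" "degree P = n" "lead_coeff P = 1"
    "pcompose P [:0, b, 1:] = P\<^sup>2 + smult b P" for n P
    by (rule monic_commuting_with_quadratic_unique[OF that(1) deg[OF that(1)] monic[OF that(1)]
          that(2,3) commb[OF that(1)] that(4)])
  consider "b = 0" "p = 0" "q = 0" | "b = 2" | "b = 4"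
    using cubic_commutes_quadratic comm[of 3 2] unfolding f2 f3 by auto
  then show ?thesis
  proof cases
    case 1
    then have "f 3 = f 2 * [:0, 1:]" by (simp add: f2 f3)
    then have "f 2 dvd f 3" by (rule dvdI)
    then show ?thesis using divides[of 2 3] by simp
  next
    case 2
    have "f n = [:1, 1:] ^ n - 1" if n: "n > 0" for n
    proof (rule unique[OF n])
      have d: "degree ([:1, 1 :: rat:] ^ n) = n" by (simp add: degree_power_eq)
      show dn: "degree ([:1, 1 :: rat:] ^ n - 1) = n"
        using degree_add_eq_left[of "- 1" "[:1, 1 :: rat:] ^ n"] d n by simp
      have "lead_coeff ([:1, 1 :: rat:] ^ n) = 1" by (simp add: lead_coeff_power)
      then show "lead_coeff ([:1, 1 :: rat:] ^ n - 1) = 1"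
        unfolding dn d using n by simp
      \<comment> \<open>Since x^2 + 2x = (x + 1)^2 - 1, the shift by 1 turns \<open>f 2\<close> into
        squaring, which commutes with powers.\<close>
      have "pcompose [:1, 1:] [:0, 2, 1 :: rat:] = [:1, 1:]\<^sup>2"
        by (simp add: pcompose_pCons power2_eq_square)
      then have "pcompose ([:1, 1 :: rat:] ^ n - 1) [:0, 2, 1:] = ([:1, 1:] ^ n)\<^sup>2 - 1"
        by (simp only: pcompose_diff pcompose_power pcompose_1 power_commutes flip: power_mult)
          (simp add: mult.commute)
      also have "\<dots> = ([:1, 1:] ^ n - 1)\<^sup>2 + 2 * ([:1, 1:] ^ n - 1)"
        by algebra
      finally show "pcompose ([:1, 1:] ^ n - 1) [:0, b, 1:]
          = ([:1, 1:] ^ n - 1)\<^sup>2 + smult b ([:1, 1:] ^ n - 1)"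
        unfolding 2 by (simp add: numeral_poly)
    qed
    then show ?thesis by blast
  next
    case 3
    define h :: "nat \<Rightarrow> rat poly"
      where "h n = 2 * pcompose (chebyshev_T n) [:1, 1/2:] - 2" for n
    have "f n = h n" if "n > 0" for n
      using that chebyshev_shift_monic[of n h] chebyshev_shift_commutes[of h n] unfolding 3[symmetric]
      by (intro unique) (simp_all add: h_def)
    then show ?thesis unfolding h_def by blast
  qed
qed

theorem corollary1p7:
  fixes f :: "nat \<Rightarrow> rat poly"
  assumes chain: "poly_chain f"
    and monic: "\<And>n. n > 0 \<Longrightarrow> lead_coeff (f n) = 1"
    and integral: "\<And>n i. n > 0 \<Longrightarrow> coeff (f n) i \<in> \<int>"
    and divides: "\<And>m n. m > 0 \<Longrightarrow> n > 0 \<Longrightarrow> m dvd n \<longleftrightarrow> f m dvd f n"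
  shows "((\<forall>n>0. f n = 2 * pcompose (chebyshev_T n) [:1, 1/2:] - 2) \<or>
          (\<forall>n>0. f n = [:1, 1:] ^ n - 1)) \<and>
         (\<forall>m>0. \<forall>n>0. gcd (f m) (f n) = f (gcd m n))"
proof -
  have deg: "degree (f n) = n" if "n > 0" for n
    using chain that by (simp add: poly_chain_def)
  note cases = poly_chain_classification[OF chain monic divides]
  have "gcd (f m) (f n) = f (gcd m n)" if mn: "m > 0" "n > 0" for m n
  proof -
    have g: "gcd m n > 0" using mn by simp
    \<comment> \<open>Both sides of the gcd formula are normalized, so mutual divisibility will
      suffice for equality.\<close>
    have norm: "normalize (f (gcd m n)) = f (gcd m n)"
      using monic[OF g] by (simp add: normalize_poly_eq_map_poly)
    have dvd: "f (gcd m n) dvd gcd (f m) (f n)"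
      using divides[OF g mn(1)] divides[OF g mn(2)] by simp
    have "degree (gcd (f m) (f n)) \<le> gcd m n"
      using cases
    proof
      assume "\<forall>n>0. f n = 2 * pcompose (chebyshev_T n) [:1, 1/2:] - 2"
      then show ?thesis using mn by (intro degree_gcd_chebyshev_shift_le) auto
    next
      assume "\<forall>n>0. f n = [:1, 1:] ^ n - 1"
      then have "gcd (f m) (f n) = normalize (f (gcd m n))"
        using mn g by (simp only: gcd_power_minus_1)
      then show ?thesis using norm deg[OF g] by simp
    qed
    moreover have "gcd (f m) (f n) \<noteq> 0" using deg[OF mn(1)] mn by auto
    ultimately have "gcd (f m) (f n) dvd f (gcd m n)"
    proof -
      \<comment> \<open>The degree bound leaves degree 0 for the cofactor \<open>k\<close>, hence a
        unit over the field.\<close>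
      obtain k where k: "gcd (f m) (f n) = f (gcd m n) * k" using dvd by (rule dvdE)
      assume "degree (gcd (f m) (f n)) \<le> gcd m n" "gcd (f m) (f n) \<noteq> 0"
      then have "is_unit k"
        using deg[OF g] by (auto simp: k degree_mult_eq is_unit_iff_degree)
      then show ?thesis unfolding k by (simp add: mult_unit_dvd_iff)
    qed
    with dvd show ?thesis
      using norm by (metis associated_eqI normalize_gcd)
  qed
  with cases show ?thesis by blast
qed

end
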